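(* Let $\mathbf A=(A,R,{}')$ be a directed relational system with involution and $|$ a Sheffer operation assigned to $\mathbf A$. Then the following hold: (i) $R$ is antisymmetric if and only if for all $x,y\in A$, $x|y=y'$ and $y|x=x'$ together imply $x=y$. (ii) If $x|y=y|x$ for all $x,y\in A$, then $R$ is antisymmetric.
   Context: A binary relation $R$ is antisymmetric if $(x,y),(y,x)\in R$ implies $x=y$. For a binary relation $R$ on a non-empty set $A$ and $a,b\in A$, let $U(a,b):=\{x\in A\mid (a,x),(b,x)\in R\}$ and $L(a,b):=\{x\in A\mid (x,a),(x,b)\in R\}$. A directed relational system with involution is a triple $(A,R,{}')$ where $A$ is a non-empty set, $R$ is a reflexive binary relation on $A$, $U(x,y)\neq\emptyset$ and $L(x,y)\neq\emptyset$ for all $x,y\in A$, and $'$ is a unary operation on $A$ such that $x''=x$ for all $x\in A$ and $(x,y)\in R$ implies $(y',x')\in R$ for all $x,y\in A$. A Sheffer operation assigned to $\mathbf A=(A,R,{}')$ is a binary operation $|$ on $A$ such that for all $x,y\in A$: $x|y=y'$ if $(x',y')\in R$, and $x|y$ is an (arbitrary) element of $U(x',y')$ otherwise. (Every such operation satisfies $(x|y)|(x|x)=x$ and $(x|y)|(y|y)=y$ for all $x,y\in A$.) *)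

theory Defs imports Main begin

definition upper_cone :: "'a set \<Rightarrow> 'a rel \<Rightarrow> 'a \<Rightarrow> 'a \<Rightarrow> 'a set" where
  "upper_cone A R a b = {x \<in> A. (a, x) \<in> R \<and> (b, x) \<in> R}"

definition lower_cone :: "'a set \<Rightarrow> 'a rel \<Rightarrow> 'a \<Rightarrow> 'a \<Rightarrow> 'a set" where
  "lower_cone A R a b = {x \<in> A. (x, a) \<in> R \<and> (x, b) \<in> R}"

(* R \<subseteq> A \<times> A is stated separately because refl_on does not include it.
   Only the values of the operation on A matter. *)
locale directed_relational_system_with_involution =
  fixes A :: "'a set" and R :: "'a rel" and compl :: "'a \<Rightarrow> 'a"
  assumes carrier_nonempty: "A \<noteq> {}"
    and rel_on_carrier: "R \<subseteq> A \<times> A"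
    and reflexive: "refl_on A R"
    and upper_cone_nonempty: "x \<in> A \<Longrightarrow> y \<in> A \<Longrightarrow> upper_cone A R x y \<noteq> {}"
    and lower_cone_nonempty: "x \<in> A \<Longrightarrow> y \<in> A \<Longrightarrow> lower_cone A R x y \<noteq> {}"
    and compl_closed: "x \<in> A \<Longrightarrow> compl x \<in> A"
    and compl_compl: "x \<in> A \<Longrightarrow> compl (compl x) = x"
    and compl_antitone: "x \<in> A \<Longrightarrow> y \<in> A \<Longrightarrow> (x, y) \<in> R \<Longrightarrow> (compl y, compl x) \<in> R"

(* Both branches take values in A when A, R, compl form such a system,
   so closure of the operation need not be required separately. *)
definition sheffer_operation ::
  "'a set \<Rightarrow> 'a rel \<Rightarrow> ('a \<Rightarrow> 'a) \<Rightarrow> ('a \<Rightarrow> 'a \<Rightarrow> 'a) \<Rightarrow> bool" where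
  "sheffer_operation A R compl s \<longleftrightarrow>
     (\<forall>x\<in>A. \<forall>y\<in>A.
        if (compl x, compl y) \<in> R then s x y = compl y
        else s x y \<in> upper_cone A R (compl x) (compl y))"

end

theory Submission imports Defs begin

text \<open>
  The relation can be read off from the operation: \<open>s x y = compl y\<close> holds exactly when
  \<open>(y, x) \<in> R\<close> (lemma \<open>sheffer_eq_compl_iff\<close>). The arbitrary choice made by a Sheffer operation
  cannot blur this, since a value chosen from the upper cone lies above \<open>compl x\<close> and so differs
  from \<open>compl y\<close> whenever \<open>(compl x, compl y) \<notin> R\<close>. Hence the two equations in the first part say
  precisely that \<open>x\<close> and \<open>y\<close> are related in both directions. For such a pair, commutativity
  of \<open>s\<close> forces \<open>compl y = compl x\<close>, and the involution is injective.
\<close>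

context directed_relational_system_with_involution
begin

lemma compl_rel_iff:
  assumes "x \<in> A" and "y \<in> A"
  shows "(compl x, compl y) \<in> R \<longleftrightarrow> (y, x) \<in> R"
  using assms compl_antitone[of y x] compl_antitone[of "compl x" "compl y"]
  by (auto simp: compl_closed compl_compl)

lemma compl_inj_on: "inj_on compl A"
  by (metis compl_compl inj_onI)

lemma sheffer_eq_compl_iff:
  assumes s: "sheffer_operation A R compl s" and xy: "x \<in> A" "y \<in> A"
  shows "s x y = compl y \<longleftrightarrow> (y, x) \<in> R"
proof -
  have "s x y = compl y \<longleftrightarrow> (compl x, compl y) \<in> R"
    using s xy unfolding sheffer_operation_def upper_cone_def
    by (cases "(compl x, compl y) \<in> R") force+
  then show ?thesis
    using compl_rel_iff[OF xy] by simp
qed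

lemma antisym_iff_on_carrier:
  "antisym R \<longleftrightarrow> (\<forall>x\<in>A. \<forall>y\<in>A. (y, x) \<in> R \<and> (x, y) \<in> R \<longrightarrow> x = y)"
  using rel_on_carrier unfolding antisym_def by blast

end

theorem theorem4p2:
  fixes A :: "'a set" and R :: "'a rel"
    and compl :: "'a \<Rightarrow> 'a" and s :: "'a \<Rightarrow> 'a \<Rightarrow> 'a"
  assumes "directed_relational_system_with_involution A R compl"
    and "sheffer_operation A R compl s"
  shows "(antisym R \<longleftrightarrow>
            (\<forall>x\<in>A. \<forall>y\<in>A. s x y = compl y \<and> s y x = compl x \<longrightarrow> x = y))
         \<and> ((\<forall>x\<in>A. \<forall>y\<in>A. s x y = s y x) \<longrightarrow> antisym R)"
proof -
  interpret directed_relational_system_with_involution A R compl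
    by (rule assms(1))
  have antisym_iff: "antisym R \<longleftrightarrow>
      (\<forall>x\<in>A. \<forall>y\<in>A. s x y = compl y \<and> s y x = compl x \<longrightarrow> x = y)"
    using antisym_iff_on_carrier sheffer_eq_compl_iff[OF assms(2)] by simp
  have "antisym R" if comm: "\<forall>x\<in>A. \<forall>y\<in>A. s x y = s y x"
    unfolding antisym_iff
  proof (intro ballI impI)
    fix x y
    assume xy: "x \<in> A" "y \<in> A" and eqs: "s x y = compl y \<and> s y x = compl x"
    then have "compl x = compl y"
      using comm by metis
    then show "x = y"
      using compl_inj_on xy by (simp add: inj_on_eq_iff)
  qed
  with antisym_iff show ?thesis by blast
qed

end
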